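(* Let $G$ be a connected self-centered graph on $p$ vertices with diameter $d$. Then $$E_\epsilon(G)\leq\frac{2W_\epsilon(G)}{p}+\sqrt{2(p-1)W_\epsilon(G)\left(d-\frac{2W_\epsilon(G)}{p^2}\right)}.$$ Equality holds if and only if $G$ is an $\epsilon$-regular graph with exactly two distinct $\epsilon$-eigenvalues $\frac{2W_\epsilon(G)}{p}$ and $-\sqrt{\frac{\|\epsilon(G)\|_2^2-\frac{4W_\epsilon(G)^2}{p^2}}{p-1}}$, or with exactly three distinct $\epsilon$-eigenvalues $\frac{2W_\epsilon(G)}{p}$, $-\sqrt{\frac{\|\epsilon(G)\|_2^2-\frac{4W_\epsilon(G)^2}{p^2}}{p-1}}$ and $\sqrt{\frac{\|\epsilon(G)\|_2^2-\frac{4W_\epsilon(G)^2}{p^2}}{p-1}}$.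
   Context: Graphs are finite, simple, undirected. For a connected graph $G$ with vertices $v_1,\ldots,v_p$, $d(v_i,v_j)$ is the distance and $e(v_i)=\max_j d(v_i,v_j)$ the eccentricity; $G$ is self-centered if all vertices have the same eccentricity. The eccentricity matrix $\epsilon(G)$ has $(i,j)$ entry $d(v_i,v_j)$ if $d(v_i,v_j)=\min\{e(v_i),e(v_j)\}$ and $0$ otherwise; its eigenvalues are the $\epsilon$-eigenvalues. $E_\epsilon(G)$ is the sum of the absolute values of the $\epsilon$-eigenvalues; $W_\epsilon(G)=\frac12\sum_{i,j}(\epsilon(G))_{ij}$; $\|\epsilon(G)\|_2$ is the Frobenius norm $\big(\sum_{i,j}(\epsilon(G))_{ij}^2\big)^{1/2}$. $G$ is $\epsilon$-regular if all row sums $\sum_j(\epsilon(G))_{ij}$ are equal. *)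

theory Defs
  imports Complex_Main "Graph_Theory.Graph_Theory" "Jordan_Normal_Form.Spectral_Radius"
begin

definition graph_dist :: "('a, 'b) pre_digraph \<Rightarrow> 'a \<Rightarrow> 'a \<Rightarrow> nat" where
  "graph_dist G u v = (LEAST n. \<exists>p. pre_digraph.apath G u p v \<and> length p = n)"

definition eccentricity :: "('a, 'b) pre_digraph \<Rightarrow> 'a \<Rightarrow> nat" where
  "eccentricity G u = Max (graph_dist G u ` verts G)"

definition diameter :: "('a, 'b) pre_digraph \<Rightarrow> nat" where
  "diameter G = Max (eccentricity G ` verts G)"

definition self_centered :: "('a, 'b) pre_digraph \<Rightarrow> bool" where
  "self_centered G \<longleftrightarrow>
     (\<forall>u \<in> verts G. \<forall>v \<in> verts G. eccentricity G u = eccentricity G v)"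

text \<open>
  In the following, the list \<open>vs\<close> enumerates the vertices of the graph without repetition;
  it fixes the order of the rows and columns of the eccentricity matrix.
\<close>

definition ecc_matrix :: "('a, 'b) pre_digraph \<Rightarrow> 'a list \<Rightarrow> real mat" where
  "ecc_matrix G vs = mat (length vs) (length vs) (\<lambda>(i, j).
     if graph_dist G (vs ! i) (vs ! j) = min (eccentricity G (vs ! i)) (eccentricity G (vs ! j))
     then real (graph_dist G (vs ! i) (vs ! j)) else 0)"

text \<open>
  Eigenvalues are taken over the complex numbers, and the energy counts each of them with its
  multiplicity as a root of the characteristic polynomial, so that neither definition relies on
  the spectral theorem for real symmetric matrices.
\<close>

definition ecc_eigenvalues :: "('a, 'b) pre_digraph \<Rightarrow> 'a list \<Rightarrow> complex set" where
  "ecc_eigenvalues G vs = spectrum (map_mat complex_of_real (ecc_matrix G vs))"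

definition ecc_energy :: "('a, 'b) pre_digraph \<Rightarrow> 'a list \<Rightarrow> real" where
  "ecc_energy G vs = (\<Sum>z \<in> ecc_eigenvalues G vs.
     real (Polynomial.order z (char_poly (map_mat complex_of_real (ecc_matrix G vs)))) * cmod z)"

definition ecc_wiener :: "('a, 'b) pre_digraph \<Rightarrow> 'a list \<Rightarrow> real" where
  "ecc_wiener G vs =
     1 / 2 * (\<Sum>i < length vs. \<Sum>j < length vs. ecc_matrix G vs $$ (i, j))"

definition frobenius_norm :: "real mat \<Rightarrow> real" where
  "frobenius_norm A = sqrt (\<Sum>i < dim_row A. \<Sum>j < dim_col A. (A $$ (i, j))\<^sup>2)"

definition ecc_regular :: "('a, 'b) pre_digraph \<Rightarrow> 'a list \<Rightarrow> bool" where
  "ecc_regular G vs \<longleftrightarrow> (\<forall>i < length vs. \<forall>k < length vs.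
     (\<Sum>j < length vs. ecc_matrix G vs $$ (i, j)) = (\<Sum>j < length vs. ecc_matrix G vs $$ (k, j)))"

end

theory Submission
  imports Defs
begin

text \<open>
  The matrix of a self-centered graph of diameter \<open>d\<close> has entries in \<open>{0, d}\<close>, so its squared
  Frobenius norm is \<open>S = 2 * d * W\<close>; every row contains an entry \<open>d\<close>, so the average row sum
  \<open>a = 2 * W / p\<close> satisfies \<open>S \<le> p * a\<^sup>2\<close>. By the spectral theorem the eigenvalues are real, sum
  to \<open>0\<close>, have square sum \<open>S\<close>, and the largest one is at least \<open>a\<close> (Rayleigh quotient of the
  all-ones vector), with equality only if that vector is an eigenvector.
  Define \<open>\<theta>\<close> by \<open>(p - 1) * \<theta>\<^sup>2 = S - a\<^sup>2\<close>, so that \<open>\<theta> \<le> a\<close>. Summing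
  \<open>2 * \<theta> * \<bar>x\<bar> \<le> x\<^sup>2 + \<theta>\<^sup>2\<close> over the eigenvalues other than the largest gives the bound
  \<open>a + (p - 1) * \<theta>\<close>; it is attained only if the largest is \<open>a\<close> and all others are \<open>\<plusminus>\<theta>\<close>, and
  the vanishing trace then forces \<open>-\<theta>\<close> to occur.
\<close>

section \<open>The spectral theorem for real symmetric matrices\<close>

text \<open>Over the complex numbers an eigenvector exists. Symmetry makes its eigenvalue real, so
  its real and imaginary parts both satisfy the eigenvalue equation, and a nonzero one among them is
  normalised.\<close>

lemma symmetric_real_eigenvector:
  fixes A :: "real mat"
  assumes A: "A \<in> carrier_mat n n" and sym: "A\<^sup>T = A" and n: "n > 0"
  obtains v l where "v \<in> carrier_vec n" "v \<bullet> v = 1" "A *\<^sub>v v = l \<cdot>\<^sub>v v"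
proof -
  let ?C = "map_mat complex_of_real A"
  have C: "?C \<in> carrier_mat n n" using A by simp
  have "spectrum ?C \<noteq> {}" using spectrum_non_empty[OF C] n by simp
  then obtain \<mu> where "eigenvalue ?C \<mu>" unfolding spectrum_def by auto
  then obtain z where z: "z \<in> carrier_vec n" "z \<noteq> 0\<^sub>v n" "?C *\<^sub>v z = \<mu> \<cdot>\<^sub>v z"
    unfolding eigenvalue_def eigenvector_def using C by auto
  define x where "x = map_vec Re z"
  define y where "y = map_vec Im z"
  define a where "a = Re \<mu>"
  define b where "b = Im \<mu>"
  have x: "x \<in> carrier_vec n" and y: "y \<in> carrier_vec n" using z by (auto simp: x_def y_def)
  have comp: "(\<Sum>j<n. complex_of_real (A $$ (i,j)) * z $ j) = \<mu> * z $ i" if "i < n" for i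
    using arg_cong[OF z(3), of "\<lambda>v. v $ i"] that A z(1)
    by (simp add: scalar_prod_def lessThan_atLeast0)
  have Ax: "A *\<^sub>v x = a \<cdot>\<^sub>v x - b \<cdot>\<^sub>v y"
  proof (rule eq_vecI)
    fix i assume "i < dim_vec (a \<cdot>\<^sub>v x - b \<cdot>\<^sub>v y)"
    hence i: "i < n" using y by simp
    show "(A *\<^sub>v x) $ i = (a \<cdot>\<^sub>v x - b \<cdot>\<^sub>v y) $ i"
      using arg_cong[OF comp[OF i], of Re] i A z x y
      by (simp add: scalar_prod_def lessThan_atLeast0 x_def y_def a_def b_def)
  qed (use A y in auto)
  have Ay: "A *\<^sub>v y = b \<cdot>\<^sub>v x + a \<cdot>\<^sub>v y"
  proof (rule eq_vecI)
    fix i assume "i < dim_vec (b \<cdot>\<^sub>v x + a \<cdot>\<^sub>v y)"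
    hence i: "i < n" using y by simp
    show "(A *\<^sub>v y) $ i = (b \<cdot>\<^sub>v x + a \<cdot>\<^sub>v y) $ i"
      using arg_cong[OF comp[OF i], of Im] i A z x y
      by (simp add: scalar_prod_def lessThan_atLeast0 x_def y_def a_def b_def)
  qed (use A y in auto)
  \<comment> \<open>Expanding both sides by \<open>Ax\<close> and \<open>Ay\<close>, the terms in
    \<open>a\<close> cancel and only \<open>b\<close> times the squared length of \<open>z\<close>
    remains.\<close>
  have "(A *\<^sub>v x) \<bullet> y = x \<bullet> (A *\<^sub>v y)"
    using transpose_vec_mult_scalar[OF A x y] sym A x y
    by (metis comm_scalar_prod mult_mat_vec_carrier)
  hence "b * (x \<bullet> x + y \<bullet> y) = 0"
    using x y comm_scalar_prod[OF x y] unfolding Ax Ay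
    by (simp add: minus_scalar_prod_distrib[of _ n] scalar_prod_add_distrib[of _ n] algebra_simps)
  moreover have xy: "x \<noteq> 0\<^sub>v n \<or> y \<noteq> 0\<^sub>v n"
  proof (rule ccontr)
    assume "\<not> ?thesis"
    hence xy0: "x = 0\<^sub>v n" "y = 0\<^sub>v n" by auto
    have "z $ i = 0" if "i < n" for i
      using arg_cong[OF xy0(1), of "\<lambda>v. v $ i"] arg_cong[OF xy0(2), of "\<lambda>v. v $ i"] that z
      by (simp add: x_def y_def complex_eq_iff)
    hence "z = 0\<^sub>v n" using z by (intro eq_vecI) auto
    thus False using z by simp
  qed
  have pos: "w \<bullet> w \<ge> 0 \<and> (w \<bullet> w = 0 \<longleftrightarrow> w = 0\<^sub>v n)" if "w \<in> carrier_vec n" for w :: "real vec"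
    using conjugate_square_eq_0_vec[OF that] conjugate_square_ge_0_vec[of w] that
    by (auto simp: conjugate_vec_def scalar_prod_def)
  have "b = 0"
    using xy pos[OF x] pos[OF y] calculation
    by (metis add_nonneg_eq_0_iff mult_eq_0_iff)
  have "A *\<^sub>v x = a \<cdot>\<^sub>v x" "A *\<^sub>v y = a \<cdot>\<^sub>v y"
    unfolding Ax Ay using x y by (auto simp: \<open>b = 0\<close> intro!: eq_vecI)
  then obtain u where u: "u \<in> carrier_vec n" "u \<noteq> 0\<^sub>v n" "A *\<^sub>v u = a \<cdot>\<^sub>v u"
    using xy x y by blast
  define c where "c = 1 / sqrt (u \<bullet> u)"
  have upos: "u \<bullet> u > 0" using pos[OF u(1)] u(2) by auto
  show thesis
  proof
    show "c \<cdot>\<^sub>v u \<in> carrier_vec n" using u by simp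
    show "(c \<cdot>\<^sub>v u) \<bullet> (c \<cdot>\<^sub>v u) = 1" using upos u by (simp add: c_def field_simps)
    show "A *\<^sub>v (c \<cdot>\<^sub>v u) = a \<cdot>\<^sub>v (c \<cdot>\<^sub>v u)"
      using u A by (simp add: mult_mat_vec smult_smult_assoc mult.commute)
  qed
qed

text \<open>\<open>H\<close> is the Householder reflection along \<open>w\<close>, the difference of
  \<open>v\<close> and the first basis vector; it exchanges these two vectors.\<close>

lemma reflection_to_unit_vector:
  fixes v :: "real vec"
  assumes v: "v \<in> carrier_vec n" "v \<bullet> v = 1" and n: "n > 0"
  obtains H where "H \<in> carrier_mat n n" "H\<^sup>T = H" "H * H = 1\<^sub>m n" "col H 0 = v"
proof -
  define w where "w i = v $ i - (if i = 0 then 1 else 0)" for i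
  define S where "S = (\<Sum>i<n. w i * w i)"
  \<comment> \<open>If \<open>v\<close> is already the first basis vector, then \<open>S = 0\<close> and \<open>2 / S = 0\<close>, so \<open>H\<close> is the identity.\<close>
  define c where "c = 2 / S"
  define H where "H = mat n n (\<lambda>(i,j). (if i = j then 1 else 0) - c * w i * w j)"
  have vv: "(\<Sum>i<n. v $ i * v $ i) = 1" using v by (simp add: scalar_prod_def lessThan_atLeast0)
  have "S = (\<Sum>i<n. v $ i * v $ i - (if i = 0 then 2 * v $ 0 - 1 else 0))"
    unfolding S_def w_def by (intro sum.cong) (auto simp: algebra_simps)
  also have "\<dots> = 2 - 2 * v $ 0" using n vv by (simp add: sum_subtractf)
  finally have S: "S = 2 - 2 * v $ 0" .
  have cS: "c * c * S = 2 * c" by (simp add: c_def)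
  \<comment> \<open>Since \<open>w 0 = v $ 0 - 1\<close> is \<open>- S / 2\<close>, the factor
    \<open>c * w 0\<close> is -1 unless \<open>w\<close> vanishes. Column 0 of \<open>H\<close> is
    therefore the first basis vector plus \<open>w\<close>, which is \<open>v\<close>.\<close>
  have w0: "c * w 0 * w i = - w i" if "i < n" for i
  proof (cases "S = 0")
    case True
    hence "\<forall>i<n. w i * w i = 0" unfolding S_def by (subst (asm) sum_nonneg_eq_0_iff) auto
    thus ?thesis using that by simp
  next
    case False
    have "c * w 0 = -1" using False S by (simp add: c_def w_def field_simps)
    thus ?thesis by simp
  qed
  show thesis
  proof
    show H: "H \<in> carrier_mat n n" by (simp add: H_def)
    show "H\<^sup>T = H" by (rule eq_matI) (auto simp: H_def)
    show "col H 0 = v"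
    proof (rule eq_vecI)
      fix i assume "i < dim_vec v"
      hence i: "i < n" using v by simp
      show "col H 0 $ i = v $ i"
        using w0[OF i] i n by (simp add: H_def w_def algebra_simps)
    qed (use v H in auto)
    show "H * H = 1\<^sub>m n"
    proof (rule eq_matI)
      fix i j assume "i < dim_row (1\<^sub>m n)" "j < dim_col (1\<^sub>m n)"
      hence ij: "i < n" "j < n" by auto
      have "(H * H) $$ (i,j) = (\<Sum>k<n. ((if i = k then 1 else 0) - c * w i * w k) * ((if k = j then 1 else 0) - c * w k * w j))"
        using ij by (simp add: H_def scalar_prod_def lessThan_atLeast0)
      also have "\<dots> = (\<Sum>k<n. (if i = k then (if k = j then 1 else 0) - c * w k * w j else 0)
          - (if k = j then c * w i * w k else 0) + c * c * w i * w j * (w k * w k))"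
        by (intro sum.cong) (auto simp: algebra_simps)
      also have "\<dots> = (if i = j then 1 else 0) - 2 * c * w i * w j + c * c * w i * w j * S"
        using ij by (simp add: sum.distrib sum_subtractf S_def sum_distrib_left)
      also have "\<dots> = (if i = j then 1 else 0) + w i * w j * (c * c * S - 2 * c)" by (simp add: algebra_simps)
      finally show "(H * H) $$ (i,j) = 1\<^sub>m n $$ (i,j)" using cS ij by simp
    qed (use H in auto)
  qed
qed


abbreviation diag_of :: "nat \<Rightarrow> (nat \<Rightarrow> 'a :: zero) \<Rightarrow> 'a mat" where
  "diag_of n d \<equiv> mat n n (\<lambda>(i,j). if i = j then d i else 0)"

text \<open>Deflation: conjugating by a reflection that takes the first basis vector to a unit
  eigenvector splits off a 1 by 1 block, and the induction hypothesis diagonalises the rest.\<close>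

theorem symmetric_real_spectral:
  fixes A :: "real mat"
  assumes "A \<in> carrier_mat n n" and "A\<^sup>T = A"
  shows "\<exists>P d. P \<in> carrier_mat n n \<and> P\<^sup>T * P = 1\<^sub>m n \<and> A = P * diag_of n d * P\<^sup>T"
  using assms
proof (induction n arbitrary: A)
  case 0
  show ?case
    by (rule exI[of _ "1\<^sub>m 0"], rule exI[of _ "\<lambda>_. 0"]) (use 0 in \<open>auto intro!: eq_matI\<close>)
next
  case (Suc n)
  note A = Suc.prems(1) and sym = Suc.prems(2)
  obtain v l where v: "v \<in> carrier_vec (Suc n)" "v \<bullet> v = 1" "A *\<^sub>v v = l \<cdot>\<^sub>v v"
    using symmetric_real_eigenvector[OF A sym] by auto
  obtain H where H: "H \<in> carrier_mat (Suc n) (Suc n)" "H\<^sup>T = H" "H * H = 1\<^sub>m (Suc n)" "col H 0 = v"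
    using reflection_to_unit_vector[OF v(1,2)] by auto
  define B where "B = H * (A * H)"
  have B: "B \<in> carrier_mat (Suc n) (Suc n)" using A H by (simp add: B_def)
  have symB: "B\<^sup>T = B"
    using A H sym unfolding B_def
    by (simp add: transpose_mult[of _ "Suc n" "Suc n" _ "Suc n"] assoc_mult_mat[of _ "Suc n" "Suc n" _ "Suc n" _ "Suc n"])
  \<comment> \<open>As \<open>v\<close> is column 0 of \<open>H\<close>, its image under
    \<open>H\<close> is column 0 of \<open>H * H\<close>, the identity.\<close>
  have Hv: "H *\<^sub>v v = unit_vec (Suc n) 0"
    using col_mult2[OF H(1) H(1), of 0] H(3,4) by simp
  have "col B 0 = H *\<^sub>v (A *\<^sub>v v)"
    using col_mult2[OF H(1), of "A * H" "Suc n" 0] col_mult2[OF A H(1), of 0] A H by (simp add: B_def)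
  also have "\<dots> = l \<cdot>\<^sub>v unit_vec (Suc n) 0"
    using v H Hv by (simp add: mult_mat_vec)
  finally have colB: "col B 0 = l \<cdot>\<^sub>v unit_vec (Suc n) 0" .
  have B0: "B $$ (i,0) = (if i = 0 then l else 0)" if "i < Suc n" for i
    using arg_cong[OF colB, of "\<lambda>v. v $ i"] that B by (auto simp: unit_vec_def)
  have B0': "B $$ (0,i) = (if i = 0 then l else 0)" if "i < Suc n" for i
    using B0[OF that] arg_cong[OF symB, of "\<lambda>M. M $$ (i,0)"] that B by simp
  define C where "C = mat n n (\<lambda>(i,j). B $$ (Suc i, Suc j))"
  have C: "C \<in> carrier_mat n n" by (simp add: C_def)
  have BC: "B = four_block_mat (mat 1 1 (\<lambda>_. l)) (0\<^sub>m 1 n) (0\<^sub>m n 1) C"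
    by (rule eq_matI) (use B B0 B0' in \<open>auto simp: C_def\<close>)
  have symC: "C\<^sup>T = C"
  proof (rule eq_matI)
    fix i j assume "i < dim_row C" "j < dim_col C"
    hence "i < n" "j < n" using C by auto
    thus "C\<^sup>T $$ (i,j) = C $$ (i,j)"
      using arg_cong[OF symB, of "\<lambda>M. M $$ (Suc i, Suc j)"] B by (simp add: C_def)
  qed (use C in auto)
  obtain Q d where Q: "Q \<in> carrier_mat n n" "Q\<^sup>T * Q = 1\<^sub>m n" "C = Q * diag_of n d * Q\<^sup>T"
    using Suc.IH[OF C symC] by blast
  define d' where "d' i = (case i of 0 \<Rightarrow> l | Suc j \<Rightarrow> d j)" for i
  \<comment> \<open>\<open>K\<close> leaves the split-off coordinate fixed and acts as
    \<open>Q\<close> on the others, so it diagonalises \<open>B\<close>, and \<open>H * K\<close>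
    diagonalises \<open>A\<close>.\<close>
  define K where "K = four_block_mat (1\<^sub>m 1) (0\<^sub>m 1 n) (0\<^sub>m n 1) Q"
  have KT: "K\<^sup>T = four_block_mat (1\<^sub>m 1) (0\<^sub>m 1 n) (0\<^sub>m n 1) (Q\<^sup>T)"
    unfolding K_def using Q by (subst transpose_four_block_mat[of _ 1 1 _ n _ n]) auto
  have K: "K \<in> carrier_mat (Suc n) (Suc n)" using four_block_carrier_mat[of "1\<^sub>m 1" 1 1 Q n n] Q by (simp add: K_def)
  have KK: "K\<^sup>T * K = 1\<^sub>m (Suc n)"
    unfolding KT unfolding K_def using Q
    by (subst mult_four_block_mat[of _ 1 1 _ n _ n _ _ 1 _ n]) auto
  let ?D = "diag_of n d" and ?D' = "diag_of (Suc n) d'"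
  have D: "?D' = four_block_mat (mat 1 1 (\<lambda>_. l)) (0\<^sub>m 1 n) (0\<^sub>m n 1) ?D"
    by (rule eq_matI) (auto simp: d'_def split: nat.splits)
  have "K * ?D' * K\<^sup>T = four_block_mat (mat 1 1 (\<lambda>_. l)) (0\<^sub>m 1 n) (0\<^sub>m n 1) (Q * ?D * Q\<^sup>T)"
    unfolding D KT unfolding K_def using Q(1)
    by (subst mult_four_block_mat[of _ 1 1 _ n _ n _ _ 1 _ n], auto)+
  hence KD: "K * ?D' * K\<^sup>T = B" using BC Q(3) by simp
  have D': "?D' \<in> carrier_mat (Suc n) (Suc n)" by simp
  note assoc = assoc_mult_mat[of _ "Suc n" "Suc n" _ "Suc n" _ "Suc n"]
  have HK: "(H * K)\<^sup>T = K\<^sup>T * H" using H K by (simp add: transpose_mult[of _ "Suc n" "Suc n" _ "Suc n"])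
  have "(H * K)\<^sup>T * (H * K) = K\<^sup>T * ((H * H) * K)"
    unfolding HK using H(1) K by (simp add: assoc del: H(3))
  hence 1: "(H * K)\<^sup>T * (H * K) = 1\<^sub>m (Suc n)" using H K KK by simp
  have "(H * K) * ?D' * (H * K)\<^sup>T = H * (K * ?D' * K\<^sup>T) * H"
    unfolding HK using H(1) K D'
    by (simp add: assoc mult_carrier_mat[of _ "Suc n" "Suc n" _ "Suc n"])
  also have "\<dots> = (H * H) * A * (H * H)"
    unfolding KD B_def using H(1) A by (simp add: assoc)
  finally have 2: "A = (H * K) * ?D' * (H * K)\<^sup>T" using H(3) A by simp
  show ?case using 1 2 H K by (intro exI[of _ "H * K"] exI[of _ d']) auto
qed


text \<open>The spectral theorem in coordinates, with \<open>P i k\<close> the \<open>i\<close>-th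
  coordinate of the \<open>k\<close>-th unit eigenvector. Later arguments then only exchange finite
  sums.\<close>

lemma symmetric_real_diagonalization:
  fixes A :: "real mat"
  assumes A: "A \<in> carrier_mat n n" and sym: "A\<^sup>T = A"
  obtains P :: "nat \<Rightarrow> nat \<Rightarrow> real" and d where
    "\<And>k l. k < n \<Longrightarrow> l < n \<Longrightarrow> (\<Sum>i<n. P i k * P i l) = (if k = l then 1 else 0)"
    "\<And>i j. i < n \<Longrightarrow> j < n \<Longrightarrow> (\<Sum>k<n. P i k * P j k) = (if i = j then 1 else 0)"
    "\<And>i j. i < n \<Longrightarrow> j < n \<Longrightarrow> A $$ (i,j) = (\<Sum>k<n. d k * P i k * P j k)"
    "char_poly A = (\<Prod>k<n. [:- d k, 1:])"
proof -
  obtain P d where P: "P \<in> carrier_mat n n" "P\<^sup>T * P = 1\<^sub>m n" "A = P * diag_of n d * P\<^sup>T"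
    using symmetric_real_spectral[OF A sym] by blast
  have P': "P * P\<^sup>T = 1\<^sub>m n" using mat_mult_left_right_inverse[of "P\<^sup>T" n P] P by simp
  show thesis
  proof
    show "(\<Sum>i<n. P $$ (i,k) * P $$ (i,l)) = (if k = l then 1 else 0)" if "k < n" "l < n" for k l
      using arg_cong[OF P(2), of "\<lambda>M. M $$ (k,l)"] that P(1)
      by (simp add: scalar_prod_def lessThan_atLeast0)
    show "(\<Sum>k<n. P $$ (i,k) * P $$ (j,k)) = (if i = j then 1 else 0)" if "i < n" "j < n" for i j
      using arg_cong[OF P', of "\<lambda>M. M $$ (i,j)"] that P(1)
      by (simp add: scalar_prod_def lessThan_atLeast0)
    show "A $$ (i,j) = (\<Sum>k<n. d k * P $$ (i,k) * P $$ (j,k))" if "i < n" "j < n" for i j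
    proof -
      have "(P * diag_of n d) $$ (i,k) = P $$ (i,k) * d k" if "k < n" for k
        using P(1) that \<open>i < n\<close>
        by (simp add: scalar_prod_def if_distrib[of "\<lambda>x. _ * x"] cong: if_cong)
      moreover have "(X * P\<^sup>T) $$ (i,j) = (\<Sum>k<n. X $$ (i,k) * P $$ (j,k))"
        if "X \<in> carrier_mat n n" for X
        using that P(1) \<open>i < n\<close> \<open>j < n\<close> by (simp add: scalar_prod_def lessThan_atLeast0)
      ultimately show ?thesis
        unfolding P(3) using P(1) by (simp add: mult.commute[of "d _"])
    qed
    have "similar_mat A (diag_of n d)"
      by (rule similar_matI[of _ _ P "P\<^sup>T" n]) (use P P' A in auto)
    hence "char_poly A = char_poly (diag_of n d)" by (rule char_poly_similar)
    also have "\<dots> = (\<Prod>a \<leftarrow> diag_mat (diag_of n d). [:- a, 1:])"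
      by (rule char_poly_upper_triangular[of _ n]) auto
    also have "\<dots> = (\<Prod>k\<leftarrow>[0..<n]. [:- d k, 1:])"
      by (rule arg_cong[of _ _ prod_list]) (auto simp: diag_mat_def)
    also have "\<dots> = (\<Prod>k<n. [:- d k, 1:])"
      using prod.distinct_set_conv_list[of "[0..<n]" "\<lambda>k. [:- d k, 1:]"]
      by (simp add: lessThan_atLeast0)
    finally show "char_poly A = (\<Prod>k<n. [:- d k, 1:])" .
  qed
qed

section \<open>Multiplicities of the roots of a product of linear factors\<close>

lemma order_prod_linear:
  fixes c :: "nat \<Rightarrow> 'a :: field"
  shows "Polynomial.order z (\<Prod>k<n. [:- c k, 1:]) = card {k. k < n \<and> c k = z}"
proof (induction n)
  case (Suc n)
  have "{k. k < Suc n \<and> c k = z} = (if c n = z then insert n {k. k < n \<and> c k = z} else {k. k < n \<and> c k = z})"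
    by (auto simp: less_Suc_eq)
  moreover have "Polynomial.order z [:- c n, 1:] = (if c n = z then 1 else 0)"
    using order_power_n_n[of z 1] by (auto intro: order_0I)
  moreover have "Polynomial.order z (\<Prod>k<Suc n. [:- c k, 1:])
      = Polynomial.order z (\<Prod>k<n. [:- c k, 1:]) + Polynomial.order z [:- c n, 1:]"
    unfolding prod.lessThan_Suc by (rule order_mult, rule no_zero_divisors) (simp_all add: prod_zero_iff)
  ultimately show ?case using Suc by simp
qed (auto intro: order_0I)

text \<open>Grouping the indices by their value \<open>c k\<close> turns a sum over distinct
  eigenvalues, weighted by multiplicity, into a sum over indices. This links the definition of the
  energy to the diagonalisation.\<close>

lemma char_poly_linear_factors:
  fixes M :: "complex mat"
  assumes M: "M \<in> carrier_mat n n" and cp: "char_poly M = (\<Prod>k<n. [:- c k, 1:])"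
  shows spectrum_linear_factors: "spectrum M = c ` {..<n}"
    and sum_spectrum_linear_factors:
      "(\<Sum>z\<in>spectrum M. real (Polynomial.order z (char_poly M)) * f z) = (\<Sum>k<n. f (c k))"
proof -
  show spec: "spectrum M = c ` {..<n}"
    unfolding spectrum_root_char_poly[OF M] cp by (auto simp: poly_prod)
  have "(\<Sum>k<n. f (c k)) = (\<Sum>z\<in>c ` {..<n}. \<Sum>k\<in>{k. k \<in> {..<n} \<and> c k = z}. f (c k))"
    by (rule sum.image_gen) simp
  also have "\<dots> = (\<Sum>z\<in>c ` {..<n}. real (card {k. k < n \<and> c k = z}) * f z)"
    by (intro sum.cong) auto
  finally show "(\<Sum>z\<in>spectrum M. real (Polynomial.order z (char_poly M)) * f z) = (\<Sum>k<n. f (c k))"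
    unfolding spec cp order_prod_linear by simp
qed

section \<open>The energy of a symmetric matrix\<close>

text \<open>Twice \<theta> times the slack in the bound equals
  \<open>(d m - a) * (d m + a - 2 * \<theta>) + R\<close>. Both terms are nonnegative because
  \<theta> \<le> \<open>a\<close> \<le> \<open>d m\<close>, and equality means that both
  vanish.\<close>

lemma sum_abs_le_dominant:
  fixes d :: "'i \<Rightarrow> real"
  assumes I: "finite I" "m \<in> I" and \<theta>: "0 < \<theta>" "\<theta> \<le> a" and m: "a \<le> d m"
    and sq: "(\<Sum>i\<in>I. (d i)\<^sup>2) = a\<^sup>2 + (real (card I) - 1) * \<theta>\<^sup>2"
  shows "(\<Sum>i\<in>I. \<bar>d i\<bar>) \<le> a + (real (card I) - 1) * \<theta>"
    and "(\<Sum>i\<in>I. \<bar>d i\<bar>) = a + (real (card I) - 1) * \<theta> \<longleftrightarrow> d m = a \<and> (\<forall>i\<in>I - {m}. \<bar>d i\<bar> = \<theta>)"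
proof -
  define R where "R = (\<Sum>i\<in>I - {m}. (\<bar>d i\<bar> - \<theta>)\<^sup>2)"
  have R0: "R \<ge> 0" by (simp add: R_def sum_nonneg)
  have Rz: "R = 0 \<longleftrightarrow> (\<forall>i\<in>I - {m}. \<bar>d i\<bar> = \<theta>)"
    unfolding R_def using I by (subst sum_nonneg_eq_0_iff) auto
  have card: "real (card (I - {m})) = real (card I) - 1"
    using I by (simp add: card_Diff_singleton) (metis One_nat_def Suc_leI card_gt_0_iff empty_iff of_nat_1 of_nat_diff)
  have "R = (\<Sum>i\<in>I - {m}. (d i)\<^sup>2 + \<theta>\<^sup>2 - 2 * \<theta> * \<bar>d i\<bar>)"
    unfolding R_def by (intro sum.cong) (auto simp: power2_diff)
  also have "\<dots> = (\<Sum>i\<in>I - {m}. (d i)\<^sup>2) + (real (card I) - 1) * \<theta>\<^sup>2 - 2 * \<theta> * (\<Sum>i\<in>I - {m}. \<bar>d i\<bar>)"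
    by (simp add: sum.distrib sum_subtractf sum_distrib_left card)
  finally have "R = \<dots>" .
  moreover have "(\<Sum>i\<in>I. (d i)\<^sup>2) = (d m)\<^sup>2 + (\<Sum>i\<in>I - {m}. (d i)\<^sup>2)"
    "(\<Sum>i\<in>I. \<bar>d i\<bar>) = d m + (\<Sum>i\<in>I - {m}. \<bar>d i\<bar>)"
    using I m \<theta> by (simp_all add: sum.remove)
  ultimately have key: "2 * \<theta> * (a + (real (card I) - 1) * \<theta> - (\<Sum>i\<in>I. \<bar>d i\<bar>)) = (d m - a) * (d m + a - 2 * \<theta>) + R"
    using sq by (simp add: algebra_simps power2_eq_square)
  have prod0: "(d m - a) * (d m + a - 2 * \<theta>) \<ge> 0" using m \<theta> by (intro mult_nonneg_nonneg) auto
  have "2 * \<theta> * (a + (real (card I) - 1) * \<theta> - (\<Sum>i\<in>I. \<bar>d i\<bar>)) \<ge> 0"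
    unfolding key using prod0 R0 by simp
  thus "(\<Sum>i\<in>I. \<bar>d i\<bar>) \<le> a + (real (card I) - 1) * \<theta>"
    using \<theta> by (simp add: zero_le_mult_iff)
  have "(\<Sum>i\<in>I. \<bar>d i\<bar>) = a + (real (card I) - 1) * \<theta> \<longleftrightarrow> (d m - a) * (d m + a - 2 * \<theta>) + R = 0"
    unfolding key[symmetric] using \<theta> by auto
  also have "\<dots> \<longleftrightarrow> (d m - a) * (d m + a - 2 * \<theta>) = 0 \<and> R = 0"
    using prod0 R0 by (rule add_nonneg_eq_0_iff)
  \<comment> \<open>The second factor vanishes only if \<open>d m\<close>, \<open>a\<close> and
    \<theta> all coincide.\<close>
  also have "(d m - a) * (d m + a - 2 * \<theta>) = 0 \<longleftrightarrow> d m = a"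
    using m \<theta> by auto
  finally show "(\<Sum>i\<in>I. \<bar>d i\<bar>) = a + (real (card I) - 1) * \<theta> \<longleftrightarrow> d m = a \<and> (\<forall>i\<in>I - {m}. \<bar>d i\<bar> = \<theta>)"
    unfolding Rz .
qed


text \<open>The hypothesis on \<open>S\<close> amounts to \<theta> \<le> \<open>a\<close>. The zero
  trace serves twice: it makes \<theta> positive, and in the equality case it produces a negative
  eigenvalue.\<close>

theorem symmetric_energy_bound:
  fixes A :: "real mat" and a \<theta> :: real
  assumes A: "A \<in> carrier_mat n n" and sym: "A\<^sup>T = A" and n: "n \<ge> 2"
    and trace: "(\<Sum>i<n. A $$ (i,i)) = 0"
    and a: "a = (\<Sum>i<n. \<Sum>j<n. A $$ (i,j)) / real n" "a > 0"
    and S: "S = (\<Sum>i<n. \<Sum>j<n. (A $$ (i,j))\<^sup>2)" "S \<le> real n * a\<^sup>2"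
    and \<theta>_def: "\<theta> = sqrt ((S - a\<^sup>2) / (real n - 1))"
  defines "M \<equiv> map_mat complex_of_real A"
  defines "E \<equiv> (\<Sum>z\<in>spectrum M. real (Polynomial.order z (char_poly M)) * cmod z)"
  shows "E \<le> a + (real n - 1) * \<theta>" (is ?bound)
    and "E = a + (real n - 1) * \<theta> \<longleftrightarrow>
      (\<forall>i<n. \<forall>k<n. (\<Sum>j<n. A $$ (i,j)) = (\<Sum>j<n. A $$ (k,j))) \<and>
      (spectrum M = complex_of_real ` {a, - \<theta>} \<and> card (spectrum M) = 2 \<or>
       spectrum M = complex_of_real ` {a, - \<theta>, \<theta>} \<and> card (spectrum M) = 3)"
      (is "_ \<longleftrightarrow> ?regular \<and> ?spec")
proof -
  obtain P :: "nat \<Rightarrow> nat \<Rightarrow> real" and d where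
    col: "\<And>k l. k < n \<Longrightarrow> l < n \<Longrightarrow> (\<Sum>i<n. P i k * P i l) = (if k = l then 1 else 0)" and
    row: "\<And>i j. i < n \<Longrightarrow> j < n \<Longrightarrow> (\<Sum>k<n. P i k * P j k) = (if i = j then 1 else 0)" and
    Aij: "\<And>i j. i < n \<Longrightarrow> j < n \<Longrightarrow> A $$ (i,j) = (\<Sum>k<n. d k * P i k * P j k)" and
    cp: "char_poly A = (\<Prod>k<n. [:- d k, 1:])"
    using symmetric_real_diagonalization[OF A sym] by blast
  have M: "M \<in> carrier_mat n n" using A by (simp add: M_def)
  interpret map_poly_comm_ring_hom complex_of_real ..
  have cpM: "char_poly M = (\<Prod>k<n. [:- complex_of_real (d k), 1:])"
    unfolding M_def of_real_hom.char_poly_hom[OF A] cp by (simp add: hom_distribs)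
  have spec: "spectrum M = complex_of_real ` d ` {..<n}"
    unfolding spectrum_linear_factors[OF M cpM] by (simp add: image_image)
  have E: "E = (\<Sum>k<n. \<bar>d k\<bar>)"
    unfolding E_def sum_spectrum_linear_factors[OF M cpM] by simp
  have tr: "(\<Sum>k<n. d k) = 0"
  proof -
    have "(\<Sum>i<n. A $$ (i,i)) = (\<Sum>i<n. \<Sum>k<n. d k * (P i k * P i k))"
      by (intro sum.cong refl) (auto simp: Aij mult.assoc)
    also have "\<dots> = (\<Sum>k<n. d k * (\<Sum>i<n. P i k * P i k))"
      by (subst sum.swap) (simp add: sum_distrib_left)
    finally show ?thesis using trace col by simp
  qed
  have swap3: "(\<Sum>j<n. \<Sum>k<n. \<Sum>l<n. f j k l) = (\<Sum>k<n. \<Sum>l<n. \<Sum>j<n. f j k l)"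
    for f :: "nat \<Rightarrow> nat \<Rightarrow> nat \<Rightarrow> real"
    by (rule trans[OF sum.swap], rule sum.cong[OF refl], rule sum.swap)
  \<comment> \<open>Each squared entry becomes a double sum over eigenvalue indices; orthonormality
    of the columns of \<open>P\<close> leaves only the terms with \<open>k = l\<close>.\<close>
  have fr: "(\<Sum>k<n. (d k)\<^sup>2) = S"
  proof -
    have "S = (\<Sum>i<n. \<Sum>j<n. \<Sum>k<n. \<Sum>l<n. d k * d l * ((P i k * P i l) * (P j k * P j l)))"
      unfolding S(1) by (intro sum.cong refl) (auto simp: Aij power2_eq_square sum_product mult_ac)
    also have "\<dots> = (\<Sum>i<n. \<Sum>k<n. \<Sum>l<n. d k * d l * (P i k * P i l) * (\<Sum>j<n. P j k * P j l))"
      by (rule sum.cong[OF refl], rule trans[OF swap3]) (simp add: sum_distrib_left mult.assoc)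
    also have "\<dots> = (\<Sum>i<n. \<Sum>k<n. (d k)\<^sup>2 * (P i k * P i k))"
      by (intro sum.cong refl) (simp add: col if_distrib power2_eq_square cong: if_cong)
    also have "\<dots> = (\<Sum>k<n. (d k)\<^sup>2 * (\<Sum>i<n. P i k * P i k))"
      by (subst sum.swap) (simp add: sum_distrib_left)
    finally show ?thesis using col by simp
  qed
  \<comment> \<open>\<open>s k\<close> is the scalar product of the all-ones vector with eigenvector
    \<open>k\<close>; \<open>ss\<close> below is Parseval's identity for that vector.\<close>
  define s where "s k = (\<Sum>i<n. P i k)" for k
  have ss: "(\<Sum>k<n. (s k)\<^sup>2) = real n"
  proof -
    have "(\<Sum>k<n. (s k)\<^sup>2) = (\<Sum>k<n. \<Sum>i<n. \<Sum>j<n. P i k * P j k)"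
      by (simp add: s_def power2_eq_square sum_product)
    also have "\<dots> = (\<Sum>i<n. \<Sum>j<n. \<Sum>k<n. P i k * P j k)"
      by (rule swap3)
    finally show ?thesis using row by simp
  qed
  have rowsum: "(\<Sum>j<n. A $$ (i,j)) = (\<Sum>k<n. d k * P i k * s k)" if "i < n" for i
  proof -
    have "(\<Sum>j<n. A $$ (i,j)) = (\<Sum>j<n. \<Sum>k<n. d k * P i k * P j k)" using that by (simp add: Aij)
    thus ?thesis by (subst (asm) sum.swap) (simp add: s_def sum_distrib_left)
  qed
  \<comment> \<open>The quadratic form of \<open>A\<close> at the all-ones vector is the sum of all
    entries.\<close>
  have ray: "(\<Sum>k<n. d k * (s k)\<^sup>2) = a * real n"
  proof -
    have "a * real n = (\<Sum>i<n. \<Sum>k<n. d k * P i k * s k)" using a n rowsum by simp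
    thus ?thesis by (subst (asm) sum.swap)
      (simp add: s_def sum_distrib_left power2_eq_square mult_ac sum_distrib_right)
  qed
  obtain m where m: "m < n" "\<And>k. k < n \<Longrightarrow> d k \<le> d m"
  proof -
    have "Max (d ` {..<n}) \<in> d ` {..<n}" using n by (intro Max_in) (auto simp: lessThan_empty_iff)
    then obtain m where "m < n" "d m = Max (d ` {..<n})" by auto
    thus thesis using that by simp
  qed
  have gap: "(\<Sum>k<n. (d m - d k) * (s k)\<^sup>2) = (d m - a) * real n"
    using ray ss by (simp add: algebra_simps sum_subtractf sum_distrib_left[symmetric])
  have "0 \<le> (d m - a) * real n"
    unfolding gap[symmetric] using m by (intro sum_nonneg mult_nonneg_nonneg) auto
  hence am: "a \<le> d m" using n by (simp add: zero_le_mult_iff)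
  \<comment> \<open>All terms of \<open>gap\<close> are nonnegative and now sum to 0, so
    \<open>s k\<close> vanishes unless \<open>d k = a\<close>: the all-ones vector is an eigenvector
    for \<open>a\<close>.\<close>
  have regular: "?regular" if "d m = a"
  proof -
    have "d k * s k = a * s k" if "k < n" for k
    proof -
      have "\<forall>k\<in>{..<n}. (d m - d k) * (s k)\<^sup>2 = 0"
        using gap m \<open>d m = a\<close> by (subst sum_nonneg_eq_0_iff[symmetric]) auto
      hence "(d m - d k) * (s k)\<^sup>2 = 0" using that by blast
      thus ?thesis using \<open>d m = a\<close> by auto
    qed
    hence "(\<Sum>j<n. A $$ (i,j)) = a" if "i < n" for i
    proof -
      have "(\<Sum>j<n. A $$ (i,j)) = (\<Sum>k<n. a * (P i k * s k))"
        unfolding rowsum[OF that] using \<open>\<And>k. k < n \<Longrightarrow> d k * s k = a * s k\<close>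
        by (intro sum.cong) (auto simp: mult_ac)
      also have "\<dots> = a * (\<Sum>j<n. \<Sum>k<n. P i k * P j k)"
        by (subst sum.swap) (simp add: s_def sum_distrib_left)
      finally show ?thesis using row that by simp
    qed
    thus ?thesis by simp
  qed
  have split: "(\<Sum>k<n. f (d k)) = f (d m) + (\<Sum>k\<in>{..<n} - {m}. f (d k))" for f :: "real \<Rightarrow> real"
    using m by (simp add: sum.remove)
  \<comment> \<open>Otherwise the largest eigenvalue uses up the whole square sum, all others are 0,
    and the zero trace makes it 0 as well.\<close>
  have "S > a\<^sup>2"
  proof (rule ccontr)
    assume "\<not> ?thesis"
    moreover have "a\<^sup>2 \<le> (d m)\<^sup>2" using am a by (simp add: power_mono)
    ultimately have "(\<Sum>k\<in>{..<n} - {m}. (d k)\<^sup>2) \<le> 0" using fr split[of "\<lambda>x. x\<^sup>2"] by simp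
    hence "(\<Sum>k\<in>{..<n} - {m}. (d k)\<^sup>2) = 0" by (simp add: sum_nonneg antisym)
    hence "\<forall>k\<in>{..<n} - {m}. d k = 0" by (subst (asm) sum_nonneg_eq_0_iff) auto
    hence "d m = 0" using tr split[of "\<lambda>x. x"] by simp
    thus False using am a by simp
  qed
  hence \<theta>: "\<theta> > 0" and \<theta>sq: "\<theta>\<^sup>2 = (S - a\<^sup>2) / (real n - 1)" using n by (simp_all add: \<theta>_def)
  have sq: "(\<Sum>k<n. (d k)\<^sup>2) = a\<^sup>2 + (real (card {..<n}) - 1) * \<theta>\<^sup>2"
    unfolding \<theta>sq fr using n by simp
  have "\<theta>\<^sup>2 \<le> a\<^sup>2" unfolding \<theta>sq using n S(2) by (simp add: field_simps)
  hence \<theta>a: "\<theta> \<le> a" using a(2) by (rule power2_le_imp_le[OF _ less_imp_le])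
  have mI: "m \<in> {..<n}" using m by simp
  note dom = sum_abs_le_dominant[OF finite_lessThan mI \<theta> \<theta>a am sq, unfolded card_lessThan]
  show ?bound unfolding E by (rule dom(1))
  have iff: "E = a + (real n - 1) * \<theta> \<longleftrightarrow> d m = a \<and> (\<forall>k\<in>{..<n} - {m}. \<bar>d k\<bar> = \<theta>)"
    unfolding E by (rule dom(2))
  \<comment> \<open>As \<open>a\<close> and \<theta> are positive, the pair always has two elements,
    while the triple has three exactly when \<open>a\<close> differs from \<theta>.\<close>
  have spec_iff: "?spec \<longleftrightarrow> d ` {..<n} = {a, - \<theta>} \<or> d ` {..<n} = {a, - \<theta>, \<theta>} \<and> a \<noteq> \<theta>"
  proof -
    have "inj complex_of_real" by (simp add: inj_def)
    hence "spectrum M = complex_of_real ` X \<longleftrightarrow> d ` {..<n} = X" "card (spectrum M) = card (d ` {..<n})" for X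
      unfolding spec by (simp_all add: inj_image_eq_iff card_image inj_on_subset)
    moreover have "card {a, - \<theta>} = 2" "card {a, - \<theta>, \<theta>} = 3 \<longleftrightarrow> a \<noteq> \<theta>"
      using \<theta> a by (simp_all add: card_insert_if)
    ultimately show ?thesis by metis
  qed
  show "E = a + (real n - 1) * \<theta> \<longleftrightarrow> ?regular \<and> ?spec"
  proof
    assume "E = a + (real n - 1) * \<theta>"
    hence eq: "d m = a" "\<forall>k\<in>{..<n} - {m}. \<bar>d k\<bar> = \<theta>" using iff by auto
    have cases: "d k = a \<or> d k = \<theta> \<or> d k = - \<theta>" if "k < n" for k
      using eq that by (cases "k = m") (auto simp: abs_if split: if_splits)
    obtain k where k: "k < n" "d k < 0"
    proof (rule ccontr)
      assume "\<not> thesis"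
      hence "\<And>k. k < n \<Longrightarrow> 0 \<le> d k" using that not_less by blast
      hence "d m = 0" using tr mI sum_nonneg_eq_0_iff[of "{..<n}" d] by auto
      thus False using eq(1) a(2) by simp
    qed
    hence "d k = - \<theta>" using cases[of k] \<theta> a(2) by auto
    hence "- \<theta> \<in> d ` {..<n}" using k by (intro image_eqI[of _ _ k]) auto
    moreover have "a \<in> d ` {..<n}" using eq(1) mI by blast
    moreover have "d ` {..<n} \<subseteq> {a, - \<theta>, \<theta>}" using cases by blast
    \<comment> \<open>The triple occurs if \<theta> is an eigenvalue different from
      \<open>a\<close>, the pair otherwise.\<close>
    ultimately have "?spec" unfolding spec_iff by blast
    thus "?regular \<and> ?spec" using regular[OF eq(1)] by blast
  next
    assume "?regular \<and> ?spec"
    hence sub: "d ` {..<n} \<subseteq> {a, - \<theta>, \<theta>}" unfolding spec_iff by blast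
    hence "d m \<in> {a, - \<theta>, \<theta>}" using mI by blast
    hence dm: "d m = a" using am \<theta> \<theta>a by auto
    \<comment> \<open>The spectrum as a set leaves the multiplicity of \<open>a\<close> open.
      Termwise, the factor \<open>a + \<theta>\<close> is right for an eigenvalue \<open>a\<close>,
      and both sides are 0 for one of modulus \<theta>; so the known square sum fixes the sum of
      absolute values.\<close>
    have "(a + \<theta>) * (\<Sum>k\<in>{..<n} - {m}. \<bar>d k\<bar> - \<theta>) = (\<Sum>k\<in>{..<n} - {m}. (d k)\<^sup>2 - \<theta>\<^sup>2)"
      unfolding sum_distrib_left
    proof (rule sum.cong)
      fix k assume "k \<in> {..<n} - {m}"
      hence "d k \<in> {a, - \<theta>, \<theta>}" using sub by blast
      thus "(a + \<theta>) * (\<bar>d k\<bar> - \<theta>) = (d k)\<^sup>2 - \<theta>\<^sup>2"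
        using a(2) \<theta> by (auto simp: algebra_simps power2_eq_square)
    qed simp
    also have "\<dots> = 0" using sq split[of "\<lambda>x. x\<^sup>2"] m n by (simp add: sum_subtractf dm of_nat_diff)
    finally have "(\<Sum>k\<in>{..<n} - {m}. \<bar>d k\<bar> - \<theta>) = 0" using a(2) \<theta> by simp
    thus "E = a + (real n - 1) * \<theta>"
      unfolding E using split[of abs] m n a(2) by (simp add: sum_subtractf dm of_nat_diff)
  qed
qed


section \<open>Eccentricity matrices\<close>

text \<open>Each arc is replaced by an opposite one. The vertex sequence is tracked because its
  distinctness is what makes the reverse of a path a path.\<close>

lemma (in sym_digraph) awalk_reverse:
  assumes "awalk u p v"
  shows "\<exists>q. awalk v q u \<and> length q = length p \<and> awalk_verts v q = rev (awalk_verts u p)"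
  using assms
proof (induction p arbitrary: u)
  case Nil
  thus ?case by (intro exI[of _ "[]"]) (auto simp: awalk_Nil_iff)
next
  case (Cons e es)
  hence e: "e \<in> arcs G" "u = tail G e" "awalk (head G e) es v" by (auto simp: awalk_Cons_iff)
  obtain q where q: "awalk v q (head G e)" "length q = length es"
    "awalk_verts v q = rev (awalk_verts (head G e) es)"
    using Cons.IH[OF e(3)] by blast
  obtain e' where e': "e' \<in> arcs G" "tail G e' = head G e" "head G e' = tail G e"
    using sym_arcs e(1) unfolding symmetric_conv by metis
  have "awalk (head G e) [e'] u" using e e' by (auto simp: awalk_Cons_iff awalk_Nil_iff)
  hence w: "awalk v (q @ [e']) u" using awalk_appendI[OF q(1)] by blast
  show ?case
    using w awalk_verts_append[OF w] q e e' by (intro exI[of _ "q @ [e']"]) simp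
qed

lemma (in sym_digraph) apath_reverse:
  assumes "apath u p v"
  shows "\<exists>q. apath v q u \<and> length q = length p"
proof -
  have p: "awalk u p v" "distinct (awalk_verts u p)" using assms by (simp_all add: apath_def)
  obtain q where "awalk v q u" "length q = length p" "awalk_verts v q = rev (awalk_verts u p)"
    using awalk_reverse[OF p(1)] by blast
  thus ?thesis using p(2) by (intro exI[of _ q]) (simp add: apath_def)
qed

lemma (in sym_digraph) graph_dist_commute: "graph_dist G u v = graph_dist G v u"
proof -
  have "\<exists>q. apath v q u \<and> length q = n" if "\<exists>p. apath u p v \<and> length p = n" for u v n
    using that apath_reverse by blast
  hence "(\<lambda>n. \<exists>p. apath u p v \<and> length p = n) = (\<lambda>n. \<exists>p. apath v p u \<and> length p = n)"
    by (intro ext iffI) blast+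
  thus ?thesis unfolding graph_dist_def by (rule arg_cong)
qed

lemma (in wf_digraph) graph_dist_self:
  assumes "u \<in> verts G"
  shows "graph_dist G u u = 0"
  unfolding graph_dist_def using assms by (intro Least_eq_0) (auto simp: apath_Nil_iff)

text \<open>Connectedness provides a path, so the least length is attained by an actual path; an
  empty one would give \<open>u = v\<close>.\<close>

lemma (in sym_digraph) graph_dist_pos:
  assumes "Digraph_Component.connected G" "u \<in> verts G" "v \<in> verts G" "u \<noteq> v"
  shows "graph_dist G u v > 0"
proof -
  have "u \<rightarrow>\<^sup>* v"
    using symmetric_connected_imp_strongly_connected[OF sym_arcs assms(1)] assms(2,3)
    unfolding strongly_connected_def by blast
  hence "\<exists>n p. apath u p v \<and> length p = n" by (simp add: reachable_apath)
  hence "\<exists>p. apath u p v \<and> length p = graph_dist G u v"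
    unfolding graph_dist_def by (rule LeastI_ex)
  thus ?thesis using assms(4) by (auto simp: apath_Nil_iff intro: Nat.gr0I)
qed

section \<open>The eccentricity matrix of a self-centered graph\<close>

locale self_centered_graph = graph G for G :: "('a, 'b) pre_digraph" (structure) +
  fixes vs :: "'a list"
  assumes connected: "Digraph_Component.connected G"
    and self_centered: "self_centered G"
    and vs: "distinct vs" "set vs = verts G"
begin

abbreviation "n \<equiv> length vs"
abbreviation "A \<equiv> ecc_matrix G vs"

lemma vs_nth: "i < n \<Longrightarrow> vs ! i \<in> verts G"
  using vs nth_mem by blast

text \<open>The notion of connectedness in use includes that there is a vertex.\<close>

lemma n_pos: "n > 0"
  using connected vs unfolding Digraph_Component.connected_def strongly_connected_def by auto

lemma eccentricity_eq: "u \<in> verts G \<Longrightarrow> eccentricity G u = diameter G"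
proof -
  assume u: "u \<in> verts G"
  have "eccentricity G ` verts G = (\<lambda>_. eccentricity G u) ` verts G"
    using u self_centered unfolding self_centered_def by (intro image_cong) blast+
  hence "eccentricity G ` verts G = {eccentricity G u}" using u by (simp add: image_constant)
  thus ?thesis unfolding diameter_def by simp
qed

lemma ecc_matrix_carrier: "A \<in> carrier_mat n n"
  by (simp add: ecc_matrix_def)

text \<open>All eccentricities equal the diameter, so the minimum in the definition is the diameter
  too.\<close>

lemma ecc_matrix_entry:
  "i < n \<Longrightarrow> j < n \<Longrightarrow> A $$ (i,j) = (if graph_dist G (vs ! i) (vs ! j) = diameter G then real (diameter G) else 0)"
  by (simp add: ecc_matrix_def eccentricity_eq vs_nth)

lemma ecc_matrix_symmetric: "A\<^sup>T = A"
  by (rule eq_matI) (simp_all add: ecc_matrix_entry graph_dist_commute ecc_matrix_carrier[THEN carrier_matD(1)]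
    ecc_matrix_carrier[THEN carrier_matD(2)])

lemma ecc_matrix_diag: "i < n \<Longrightarrow> A $$ (i,i) = 0"
  by (simp add: ecc_matrix_entry graph_dist_self vs_nth)

text \<open>Every vertex has some vertex at distance equal to its eccentricity, and entries are
  nonnegative. This is the source of the inequality \<theta> \<le> \<open>a\<close>.\<close>

lemma ecc_matrix_row_sum_ge:
  assumes i: "i < n"
  shows "real (diameter G) \<le> (\<Sum>j<n. A $$ (i,j))"
proof -
  have "eccentricity G (vs ! i) \<in> graph_dist G (vs ! i) ` verts G"
    unfolding eccentricity_def using i vs_nth by (intro Max_in) auto
  then obtain v where v: "v \<in> set vs" "graph_dist G (vs ! i) v = diameter G"
    using eccentricity_eq[OF vs_nth[OF i]] vs(2) by auto
  then obtain j where j: "j < n" "graph_dist G (vs ! i) (vs ! j) = diameter G"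
    by (auto simp: in_set_conv_nth)
  hence "real (diameter G) = A $$ (i,j)" using i by (simp add: ecc_matrix_entry)
  also have "\<dots> \<le> (\<Sum>j<n. A $$ (i,j))"
    using i j by (intro member_le_sum) (auto simp: ecc_matrix_entry)
  finally show ?thesis .
qed

lemma diameter_pos:
  assumes "n \<ge> 2"
  shows "diameter G > 0"
proof -
  have 0: "vs ! 0 \<in> verts G" using assms by (intro vs_nth) linarith
  have "vs ! 0 \<noteq> vs ! 1" using assms nth_eq_iff_index_eq[OF vs(1), of 0 1] by linarith
  hence "0 < graph_dist G (vs ! 0) (vs ! 1)"
    using assms by (intro graph_dist_pos connected vs_nth) auto
  also have "\<dots> \<le> eccentricity G (vs ! 0)"
    unfolding eccentricity_def using assms by (intro Max_ge) (auto intro!: vs_nth imageI)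
  finally show ?thesis by (simp add: eccentricity_eq[OF 0])
qed

lemma ecc_wiener_ge: "real n * real (diameter G) \<le> 2 * ecc_wiener G vs"
  using sum_mono[of "{..<n}" "\<lambda>_. real (diameter G)"] ecc_matrix_row_sum_ge by (simp add: ecc_wiener_def)

text \<open>Entries are 0 or the diameter, so squaring an entry multiplies it by the
  diameter.\<close>

lemma sum_squares_ecc_matrix:
  "(\<Sum>i<n. \<Sum>j<n. (A $$ (i,j))\<^sup>2) = 2 * real (diameter G) * ecc_wiener G vs"
proof -
  have "(\<Sum>i<n. \<Sum>j<n. (A $$ (i,j))\<^sup>2) = (\<Sum>i<n. \<Sum>j<n. real (diameter G) * A $$ (i,j))"
    by (intro sum.cong) (auto simp: ecc_matrix_entry power2_eq_square)
  thus ?thesis by (simp add: ecc_wiener_def sum_distrib_left)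
qed

lemma frobenius_norm_ecc_matrix:
  "(frobenius_norm A)\<^sup>2 = (\<Sum>i<n. \<Sum>j<n. (A $$ (i,j))\<^sup>2)"
  using ecc_matrix_carrier by (simp add: frobenius_norm_def sum_nonneg)

text \<open>Settles the one-vertex graph, where the matrix is zero and the bound reads 0 \<le>
  0.\<close>

lemma ecc_energy_trivial:
  assumes "n = 1"
  shows "ecc_energy G vs = 0"
proof -
  let ?M = "map_mat complex_of_real A"
  have M: "?M \<in> carrier_mat 1 1" using ecc_matrix_carrier assms by simp
  have "upper_triangular ?M" using M by auto
  hence "char_poly ?M = (\<Prod>a \<leftarrow> diag_mat ?M. [:- a, 1:])" by (rule char_poly_upper_triangular[OF M])
  also have "\<dots> = (\<Prod>k<1::nat. [:- 0, 1:])" using assms ecc_matrix_carrier ecc_matrix_diag[of 0] by (simp add: diag_mat_def)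
  finally show ?thesis
    unfolding ecc_energy_def ecc_eigenvalues_def
    using sum_spectrum_linear_factors[OF M, of "\<lambda>_. 0" cmod] by simp
qed

end

text \<open>The equality statement is restricted to \<open>p \<ge> 2\<close>: a single vertex
  attains the bound, but its matrix has only one eigenvalue.\<close>

theorem theorem4p8:
  fixes G :: "('a, 'b) pre_digraph" and vs :: "'a list" and p d :: nat and W \<theta> :: real
  assumes "Digraph.graph G"
    and "Digraph_Component.connected G"
    and "self_centered G"
    and "distinct vs" and "set vs = verts G"
    and "p = card (verts G)"
    and "d = diameter G"
    and "W = ecc_wiener G vs"
    and "\<theta> = sqrt (((frobenius_norm (ecc_matrix G vs))\<^sup>2 - 4 * W\<^sup>2 / (real p)\<^sup>2) / (real p - 1))"
  shows "ecc_energy G vs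
           \<le> 2 * W / real p + sqrt (2 * (real p - 1) * W * (real d - 2 * W / (real p)\<^sup>2))
    \<and> (p \<ge> 2 \<longrightarrow>
        (ecc_energy G vs
           = 2 * W / real p + sqrt (2 * (real p - 1) * W * (real d - 2 * W / (real p)\<^sup>2))
         \<longleftrightarrow>
         ecc_regular G vs \<and>
         (ecc_eigenvalues G vs = complex_of_real ` {2 * W / real p, - \<theta>}
            \<and> card (ecc_eigenvalues G vs) = 2
          \<or> ecc_eigenvalues G vs = complex_of_real ` {2 * W / real p, - \<theta>, \<theta>}
            \<and> card (ecc_eigenvalues G vs) = 3)))"
proof -
  interpret self_centered_graph G vs
    using assms(1-5) by (intro self_centered_graph.intro self_centered_graph_axioms.intro)
  have p: "p = n" using assms(4-6) distinct_card by metis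
  have F: "(frobenius_norm A)\<^sup>2 = 2 * real d * W"
    unfolding frobenius_norm_ecc_matrix sum_squares_ecc_matrix assms(7,8) ..
  show ?thesis
  proof (cases "p \<ge> 2")
    case False
    hence "n = 1" using n_pos p by linarith
    hence "W = 0" using ecc_matrix_diag[of 0] by (simp add: assms(8) ecc_wiener_def)
    thus ?thesis using ecc_energy_trivial[OF \<open>n = 1\<close>] False by simp
  next
    case True
    define a where "a = 2 * W / real p"
    have W: "real p * real d \<le> 2 * W" using ecc_wiener_ge unfolding p assms(7,8) .
    have "d > 0" using diameter_pos True p assms(7) by simp
    hence "0 < real p * real d" using True by simp
    hence Wpos: "W > 0" using W by linarith
    have sums: "a = (\<Sum>i<n. \<Sum>j<n. A $$ (i,j)) / real n"
      by (simp add: a_def p assms(8) ecc_wiener_def)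
    have apos: "a > 0" using Wpos True by (simp add: a_def)
    \<comment> \<open>With \<open>W\<close>, which sums the lower bounds on the rows, this chain
      verifies the hypothesis on \<open>S\<close> of \<open>symmetric_energy_bound\<close>.\<close>
    have "2 * real d * W * real p = (real p * real d) * (2 * W)" by simp
    also have "\<dots> \<le> (2 * W) * (2 * W)" using W Wpos by (intro mult_right_mono) auto
    finally have "2 * real d * W \<le> (2 * W) * (2 * W) / real p"
      using True by (simp add: pos_le_divide_eq)
    also have "\<dots> = real n * a\<^sup>2"
      using True by (simp add: a_def p[symmetric] power2_eq_square)
    finally have "(frobenius_norm A)\<^sup>2 \<le> real n * a\<^sup>2" unfolding F .
    moreover have th: "\<theta> = sqrt (((frobenius_norm A)\<^sup>2 - a\<^sup>2) / (real n - 1))"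
      unfolding assms(9) by (simp add: a_def p power_divide power_mult_distrib)
    moreover have "(\<Sum>i<n. A $$ (i,i)) = 0" by (simp add: ecc_matrix_diag)
    ultimately have main: "ecc_energy G vs \<le> a + (real n - 1) * \<theta>"
      "ecc_energy G vs = a + (real n - 1) * \<theta> \<longleftrightarrow> ecc_regular G vs \<and>
        (ecc_eigenvalues G vs = complex_of_real ` {a, - \<theta>} \<and> card (ecc_eigenvalues G vs) = 2 \<or>
         ecc_eigenvalues G vs = complex_of_real ` {a, - \<theta>, \<theta>} \<and> card (ecc_eigenvalues G vs) = 3)"
      using symmetric_energy_bound[OF ecc_matrix_carrier ecc_matrix_symmetric _ _ sums apos
          frobenius_norm_ecc_matrix _ th] True p
      unfolding ecc_energy_def ecc_eigenvalues_def ecc_regular_def by blast+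
    \<comment> \<open>Moving the factor \<open>real p - 1\<close> under the root turns the general
      bound into the stated one.\<close>
    have "(real p - 1) * \<theta> = sqrt ((real p - 1)\<^sup>2) * sqrt ((2 * real d * W - a\<^sup>2) / (real p - 1))"
      unfolding th F p using True p by simp
    also have "\<dots> = sqrt ((real p - 1)\<^sup>2 * ((2 * real d * W - a\<^sup>2) / (real p - 1)))"
      by (rule real_sqrt_mult[symmetric])
    also have "(real p - 1)\<^sup>2 * ((2 * real d * W - a\<^sup>2) / (real p - 1)) = (real p - 1) * (2 * real d * W - a\<^sup>2)"
      using True by (simp add: power2_eq_square)
    also have "2 * real d * W - a\<^sup>2 = 2 * W * (real d - 2 * W / (real p)\<^sup>2)"
      by (simp add: a_def power_divide power2_eq_square right_diff_distrib)
    also have "(real p - 1) * (2 * W * (real d - 2 * W / (real p)\<^sup>2))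
        = 2 * (real p - 1) * W * (real d - 2 * W / (real p)\<^sup>2)"
      by (simp only: ac_simps)
    finally show ?thesis using main unfolding p a_def by simp
  qed
qed

end
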